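(* Let $k \geq 2$ and $n \geq 1$ be integers with $(k,n) \neq (2,1)$. Let $G=(V,E)$ be an $n$-balanced $k$-partite graph. If $$|E(G)| \geq n^{2}\binom{k}{2}-(k-1)n+2,$$ then $G$ is Hamiltonian, i.e., $G$ contains a cycle passing through every vertex of $G$ exactly once.
   Context: All graphs are finite, simple and undirected. An $n$-balanced $k$-partite graph is a graph whose vertex set is partitioned into $k$ parts $V_1,\dots,V_k$ with $|V_i|=n$ for each $i$, such that no edge has both endpoints in the same part (edges between different parts may or may not be present). *)

theory Defs
  imports Complex_Main "HOL-Library.Disjoint_Sets"
begin

text \<open>Finite simple undirected graphs are given by a vertex set and a set of two-element
  vertex sets. So there are no loops or parallel edges, and \<^term>\<open>card E\<close> counts each
  undirected edge once.\<close>

definition finite_simple_graph :: "'a set \<Rightarrow> 'a set set \<Rightarrow> bool" where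
  "finite_simple_graph V E \<longleftrightarrow> finite V \<and> (\<forall>e\<in>E. e \<subseteq> V \<and> card e = 2)"

definition balanced_multipartite_graph :: "nat \<Rightarrow> nat \<Rightarrow> 'a set \<Rightarrow> 'a set set \<Rightarrow> bool" where
  "balanced_multipartite_graph n k V E \<longleftrightarrow>
     finite_simple_graph V E \<and>
     (\<exists>P :: nat \<Rightarrow> 'a set.
        (\<Union>i\<in>{1..k}. P i) = V \<and>
        disjoint_family_on P {1..k} \<and>
        (\<forall>i\<in>{1..k}. card (P i) = n) \<and>
        (\<forall>e\<in>E. \<forall>i\<in>{1..k}. \<not> e \<subseteq> P i))"

text \<open>A cycle is listed without repeating its starting vertex; the index modulo the length
  provides the closing edge. At least three vertices are required: otherwise a single
  edge traversed back and forth would count as a cycle.\<close>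

definition graph_cycle :: "'a set set \<Rightarrow> 'a list \<Rightarrow> bool" where
  "graph_cycle E xs \<longleftrightarrow>
     length xs \<ge> 3 \<and> distinct xs \<and>
     (\<forall>i<length xs. {xs ! i, xs ! ((i + 1) mod length xs)} \<in> E)"

definition hamiltonian :: "'a set \<Rightarrow> 'a set set \<Rightarrow> bool" where
  "hamiltonian V E \<longleftrightarrow> (\<exists>xs. graph_cycle E xs \<and> set xs = V)"

end

theory Submission
  imports Defs
begin

text \<open>Let \<open>D = (k - 1) * n\<close> be the degree in the complete balanced \<open>k\<close>-partite graph; at most
  \<open>D - 2\<close> of its edges are missing. If \<open>k \<ge> 3\<close> and the condition of Chvatal's theorem fails at
  \<open>h\<close>, then \<open>h\<close> vertices each miss at least \<open>D - h\<close> edges, and a further vertex misses at least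
  \<open>h + 1 - n\<close>; summing degrees gives \<open>h * (D - h) \<le> 2 * (D - 2)\<close>, that is,
  \<open>(h - 2) * (D - h - 2) \<le> 0\<close>. The range of \<open>h\<close> leaves two borderline cases: for \<open>h = 2\<close> two
  vertices share at most one missing edge, and for \<open>h = D - 2\<close> the further vertex is decisive.
  If \<open>k = 2\<close>, Chvatal's theorem is too weak for the graph itself, but it applies after one part
  has been made complete.\<close>

section \<open>Cycles as closed paths\<close>

text \<open>Trades modular indices for a path with a closing edge, so that cycles can be assembled
  by appending and reversing lists.\<close>

lemma graph_cycle_iff_successively:
  "graph_cycle E xs \<longleftrightarrow>
     length xs \<ge> 3 \<and> distinct xs \<and> successively (\<lambda>x y. {x, y} \<in> E) xs \<and> {last xs, hd xs} \<in> E"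
proof (cases "length xs \<ge> 3")
  case True
  then have ne: "xs \<noteq> []" by auto
  have last: "{xs ! i, xs ! ((i + 1) mod length xs)} = {last xs, hd xs}" if "Suc i = length xs" for i
    using that[symmetric] ne by (simp add: last_conv_nth hd_conv_nth)
  have "(\<forall>i<length xs. {xs ! i, xs ! ((i + 1) mod length xs)} \<in> E) \<longleftrightarrow>
        (\<forall>i. Suc i < length xs \<longrightarrow> {xs ! i, xs ! Suc i} \<in> E) \<and> {last xs, hd xs} \<in> E"
    (is "?L \<longleftrightarrow> ?R")
  proof
    assume L: ?L
    have "{xs ! i, xs ! Suc i} \<in> E" if "Suc i < length xs" for i
      using L[rule_format, of i] that by simp
    moreover have "Suc (length xs - 1) = length xs" using True by simp
    then have "{last xs, hd xs} \<in> E" using L last by (metis lessI)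
    ultimately show ?R by blast
  next
    assume R: ?R
    show ?L
    proof (intro allI impI)
      fix i assume "i < length xs"
      then consider "Suc i < length xs" | "Suc i = length xs" by linarith
      then show "{xs ! i, xs ! ((i + 1) mod length xs)} \<in> E"
      proof cases
        case 1 then show ?thesis using R by simp
      next
        case 2 then show ?thesis using R last by simp
      qed
    qed
  qed
  then show ?thesis
    unfolding graph_cycle_def successively_conv_nth by blast
qed (simp add: graph_cycle_def)

text \<open>The cycle must pass along \<open>{u, v}\<close>. Rotating it to start just after that
  edge, and reversing it if the ends come out swapped, leaves a path that stays in
  \<open>H\<close>.\<close>

lemma path_from_new_edge:
  assumes cyc: "graph_cycle (insert {u, v} H) xs" and no: "\<not> graph_cycle H xs"
  obtains ys where "distinct ys" "set ys = set xs" "length ys = length xs"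
    "successively (\<lambda>x y. {x, y} \<in> H) ys" "hd ys = u" "last ys = v"
proof -
  define N where "N = length xs"
  have N: "N \<ge> 3" and d: "distinct xs"
    and e: "\<And>i. i < N \<Longrightarrow> {xs ! i, xs ! ((i + 1) mod N)} \<in> insert {u, v} H"
    using cyc by (auto simp: graph_cycle_def N_def)
  obtain i where i: "i < N" and iH: "{xs ! i, xs ! ((i + 1) mod N)} \<notin> H"
    using no N d by (auto simp: graph_cycle_def N_def)
  have uv: "{xs ! i, xs ! ((i + 1) mod N)} = {u, v}" using e[OF i] iH by auto
  define ys where "ys = rotate (Suc i) xs"
  have ys: "distinct ys" "set ys = set xs" "length ys = N" using d by (auto simp: ys_def N_def)
  have nth: "ys ! j = xs ! ((Suc i + j) mod N)" if "j < N" for j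
    using nth_rotate[of j xs "Suc i"] that by (simp add: ys_def N_def)
  have y0: "ys ! 0 = xs ! ((i + 1) mod N)" using nth[of 0] N by simp
  have yl: "ys ! (N - 1) = xs ! i" using nth[of "N - 1"] N i by simp
  have "{ys ! j, ys ! Suc j} \<in> H" if j: "Suc j < N" for j
  proof -
    have "{ys ! j, ys ! Suc j} \<in> insert {u, v} H"
      using e[of "(Suc i + j) mod N"] nth[of j] nth[of "Suc j"] j N by (simp add: mod_Suc_eq)
    \<comment> \<open>With at least three distinct vertices the closing pair is not also a
      consecutive pair, so the new edge is used only once.\<close>
    moreover have "{ys ! j, ys ! Suc j} \<noteq> {ys ! (N - 1), ys ! 0}"
    proof
      assume "{ys ! j, ys ! Suc j} = {ys ! (N - 1), ys ! 0}"
      then consider "ys ! j = ys ! (N - 1)" | "ys ! j = ys ! 0" "ys ! Suc j = ys ! (N - 1)"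
        by (auto simp: doubleton_eq_iff)
      then show False
        using nth_eq_iff_index_eq[OF ys(1)] ys(3) j N by cases auto
    qed
    ultimately show ?thesis using uv y0 yl by auto
  qed
  then have s: "successively (\<lambda>x y. {x, y} \<in> H) ys"
    by (simp add: successively_conv_nth ys)
  have ne: "ys \<noteq> []" using ys N by auto
  have hl: "{last ys, hd ys} = {u, v}"
    using uv y0 yl ys ne by (simp add: hd_conv_nth last_conv_nth)
  show thesis
  proof (cases "hd ys = u \<and> last ys = v")
    case True
    then show thesis using that[of ys] ys s by (simp add: N_def)
  next
    case False
    then have "hd ys = v" "last ys = u" using hl by (auto simp: doubleton_eq_iff)
    then show thesis using that[of "rev ys"] ys s ne
      by (simp add: N_def hd_rev last_rev successively_rev insert_commute)
  qed
qed

text \<open>Two crossing chords from the ends of the path replace the edge between positions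
  \<open>i\<close> and \<open>Suc i\<close>: walk from the head to \<open>ys ! i\<close>, jump to
  the last vertex, walk back to \<open>ys ! Suc i\<close>, and return to the head.\<close>

lemma crossing_cycle:
  assumes d: "distinct ys" and N: "length ys \<ge> 3"
    and s: "successively (\<lambda>x y. {x, y} \<in> H) ys" and i: "Suc i < length ys"
    and u: "{hd ys, ys ! Suc i} \<in> H" and v: "{last ys, ys ! i} \<in> H"
  shows "\<exists>zs. graph_cycle H zs \<and> set zs = set ys"
proof -
  define as bs where "as = take (Suc i) ys" and "bs = drop (Suc i) ys"
  have ys: "ys = as @ bs" by (simp add: as_def bs_def)
  have ne: "as \<noteq> []" "bs \<noteq> []" using i by (auto simp: as_def bs_def)
  have la: "last as = ys ! i" using i by (simp add: as_def bs_def take_Suc_conv_app_nth)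
  have hb: "hd bs = ys ! Suc i" using i by (simp add: as_def bs_def hd_drop_conv_nth)
  have ss: "successively (\<lambda>x y. {x, y} \<in> H) as" "successively (\<lambda>x y. {x, y} \<in> H) bs"
    using s by (auto simp: ys successively_append_iff)
  have "graph_cycle H (as @ rev bs)"
    using d[unfolded ys] N[unfolded ys] ss ne u v
    unfolding la[symmetric] hb[symmetric]
    by (auto simp: graph_cycle_iff_successively successively_append_iff successively_rev
        insert_commute hd_rev last_rev ys)
  then show ?thesis by (intro exI[of _ "as @ rev bs"]) (simp add: ys)
qed

section \<open>Degrees\<close>

definition degree :: "'a set set \<Rightarrow> 'a \<Rightarrow> nat" where
  "degree E v = card {e \<in> E. v \<in> e}"

lemma degree_eq_card_neighbours:
  assumes "\<forall>e\<in>E. card e = 2"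
  shows "degree E v = card {w. {v, w} \<in> E}"
proof -
  have "bij_betw (\<lambda>w. {v, w}) {w. {v, w} \<in> E} {e \<in> E. v \<in> e}"
  proof (rule bij_betw_imageI)
    show "inj_on (\<lambda>w. {v, w}) {w. {v, w} \<in> E}" by (auto simp: inj_on_def doubleton_eq_iff)
    show "(\<lambda>w. {v, w}) ` {w. {v, w} \<in> E} = {e \<in> E. v \<in> e}"
    proof (intro equalityI subsetI)
      fix e assume e: "e \<in> {e \<in> E. v \<in> e}"
      then obtain x y where "e = {x, y}" using assms by (auto simp: card_2_iff)
      with e have "e = {v, x} \<or> e = {v, y}" by auto
      with e show "e \<in> (\<lambda>w. {v, w}) ` {w. {v, w} \<in> E}" by auto
    qed auto
  qed
  then show ?thesis by (simp add: degree_def bij_betw_same_card)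
qed

lemma degree_mono:
  assumes "E \<subseteq> H" "finite H"
  shows "degree E v \<le> degree H v"
  unfolding degree_def using assms by (intro card_mono) auto

lemma degree_Un_disjoint:
  assumes "finite E" "finite F" "E \<inter> F = {}"
  shows "degree (E \<union> F) v = degree E v + degree F v"
proof -
  have "{e \<in> E \<union> F. v \<in> e} = {e \<in> E. v \<in> e} \<union> {e \<in> F. v \<in> e}" by auto
  moreover have "{e \<in> E. v \<in> e} \<inter> {e \<in> F. v \<in> e} = {}" using assms(3) by blast
  ultimately show ?thesis using assms(1,2) by (simp add: degree_def card_Un_disjoint)
qed

text \<open>Double counting of incidences. With \<open>S\<close> the whole vertex set this becomes
  the handshake identity; with \<open>S\<close> independent it bounds the degree sum by the number
  of edges.\<close>

lemma sum_degree_eq: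
  assumes "finite E" "finite S"
  shows "(\<Sum>v\<in>S. degree E v) = (\<Sum>e\<in>E. card (e \<inter> S))"
proof -
  have "(\<Sum>v\<in>S. degree E v) = (\<Sum>v\<in>S. \<Sum>e\<in>E. if v \<in> e then 1 else 0)"
    using assms by (simp add: degree_def sum.If_cases Int_def)
  also have "\<dots> = (\<Sum>e\<in>E. \<Sum>v\<in>S. if v \<in> e then 1 else 0)" by (rule sum.swap)
  also have "\<dots> = (\<Sum>e\<in>E. card (e \<inter> S))"
    using assms by (simp add: sum.If_cases Int_def conj_commute)
  finally show ?thesis .
qed

lemma finite_simple_graph_finite:
  assumes "finite_simple_graph V E"
  shows "finite E" "finite V"
proof -
  show "finite V" using assms by (simp add: finite_simple_graph_def)
  then show "finite E" using assms
    by (intro finite_subset[of E "Pow V"]) (auto simp: finite_simple_graph_def)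
qed

section \<open>Chvatal's theorem\<close>

text \<open>Any listing of the vertices is a cycle. Hence a non-Hamiltonian graph on at least three
  vertices has a nonadjacent pair.\<close>

lemma complete_hamiltonian:
  assumes "finite V" "card V \<ge> 3"
  shows "hamiltonian V {e. e \<subseteq> V \<and> card e = 2}"
proof -
  obtain xs where xs: "set xs = V" "distinct xs"
    using finite_distinct_list[OF assms(1)] by blast
  have len: "length xs \<ge> 3" using distinct_card[OF xs(2)] xs(1) assms(2) by simp
  have "{xs ! i, xs ! ((i + 1) mod length xs)} \<in> {e. e \<subseteq> V \<and> card e = 2}"
    if i: "i < length xs" for i
  proof -
    have j: "(i + 1) mod length xs < length xs" using i by (intro mod_less_divisor) auto
    have "(i + 1) mod length xs \<noteq> i"
      using i len by (cases "i + 1 = length xs") auto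
    then have "xs ! i \<noteq> xs ! ((i + 1) mod length xs)"
      using nth_eq_iff_index_eq[OF xs(2) i j] by simp
    then show ?thesis using nth_mem[OF i] nth_mem[OF j] xs(1) by simp
  qed
  then show ?thesis unfolding hamiltonian_def graph_cycle_def using xs len by blast
qed

text \<open>Choose nonadjacent \<open>u\<close>, \<open>v\<close> with maximal degree sum and
  \<open>d u \<le> d v\<close>; a Hamiltonian path joins them. Predecessors of neighbours of
  \<open>u\<close> on it are nonadjacent to \<open>v\<close>, so they have degree at most
  \<open>d u\<close>; non-neighbours of \<open>u\<close> have degree at most \<open>d v\<close>. The
  witness is \<open>h = d u\<close>, or \<open>h = 1\<close> if \<open>u\<close> is
  isolated.\<close>

lemma maximal_non_hamiltonian:
  assumes V: "finite V" "card V \<ge> 3"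
    and simple: "\<forall>e\<in>H. e \<subseteq> V \<and> card e = 2"
    and nh: "\<not> hamiltonian V H"
    and maxi: "\<And>u v. u \<in> V \<Longrightarrow> v \<in> V \<Longrightarrow> u \<noteq> v \<Longrightarrow> {u, v} \<notin> H \<Longrightarrow>
                 hamiltonian V (insert {u, v} H)"
  shows "\<exists>h\<ge>1. 2 * h < card V \<and> h \<le> card {v \<in> V. degree H v \<le> h} \<and>
           card V - h \<le> card {v \<in> V. degree H v < card V - h}"
proof -
  define N where "N = card V"
  define d where "d = degree H"
  have dn: "d v = card {w. {v, w} \<in> H}" for v
    using degree_eq_card_neighbours[of H v] simple by (simp add: d_def)
  have nbV: "{v, w} \<in> H \<Longrightarrow> w \<in> V \<and> w \<noteq> v" for v w using simple by fastforce
  define nonadj where "nonadj = {(u, v). u \<in> V \<and> v \<in> V \<and> u \<noteq> v \<and> {u, v} \<notin> H}"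
  have fin: "finite nonadj"
    by (rule finite_subset[of _ "V \<times> V"]) (auto simp: nonadj_def V)
  have "nonadj \<noteq> {}"
  proof
    assume "nonadj = {}"
    then have "H = {e. e \<subseteq> V \<and> card e = 2}"
      using simple by (auto simp: nonadj_def card_2_iff)
    then show False using complete_hamiltonian[OF V] nh by simp
  qed
  define s where "s = (\<lambda>(u, v). d u + d v)"
  obtain p where p: "p \<in> nonadj" and pmax: "\<forall>q\<in>nonadj. s q \<le> s p"
  proof -
    have "Max (s ` nonadj) \<in> s ` nonadj" using fin \<open>nonadj \<noteq> {}\<close> by (intro Max_in) auto
    then obtain p where "p \<in> nonadj" "s p = Max (s ` nonadj)" by auto
    then show thesis using that[of p] fin by simp
  qed
  obtain u v where uv: "u \<in> V" "v \<in> V" "u \<noteq> v" "{u, v} \<notin> H" and le: "d u \<le> d v"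
    and mx: "\<And>x y. x \<in> V \<Longrightarrow> y \<in> V \<Longrightarrow> x \<noteq> y \<Longrightarrow> {x, y} \<notin> H \<Longrightarrow> d x + d y \<le> d u + d v"
  proof -
    obtain a b where ab: "p = (a, b)" by (cases p)
    have 1: "a \<in> V" "b \<in> V" "a \<noteq> b" "{a, b} \<notin> H" using p by (auto simp: ab nonadj_def)
    have 2: "d x + d y \<le> d a + d b" if "x \<in> V" "y \<in> V" "x \<noteq> y" "{x, y} \<notin> H" for x y
      using pmax that by (fastforce simp: ab nonadj_def s_def)
    show thesis
    proof (cases "d a \<le> d b")
      case True then show thesis using that[of a b] 1 2 by blast
    next
      case False then show thesis using that[of b a] 1 2
        by (simp add: insert_commute add.commute)
    qed
  qed
  obtain xs where "graph_cycle (insert {u, v} H) xs" and xs: "set xs = V"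
    using maxi[OF uv] by (auto simp: hamiltonian_def)
  moreover have "\<not> graph_cycle H xs" using nh xs by (auto simp: hamiltonian_def)
  ultimately obtain ys where ys: "distinct ys" "set ys = V"
    "successively (\<lambda>x y. {x, y} \<in> H) ys" "hd ys = u" "last ys = v"
    using path_from_new_edge by metis
  have len: "length ys = N" using distinct_card[OF ys(1)] ys(2) by (simp add: N_def)
  have N3: "N \<ge> 3" using V by (simp add: N_def)
  have ne: "ys \<noteq> []" using len N3 by auto
  \<comment> \<open>Positions just before a neighbour of \<open>u\<close>. If \<open>v\<close> were
    adjacent to the vertex at such a position, \<open>crossing_cycle\<close> would close the path
    into a Hamiltonian cycle.\<close>
  define I where "I = {i. Suc i < N \<and> {u, ys ! Suc i} \<in> H}"
  define S where "S = (\<lambda>i. ys ! i) ` I"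
  have finI: "finite I" by (rule finite_subset[of _ "{..<N}"]) (auto simp: I_def)
  have "inj_on (\<lambda>i. ys ! i) I"
    using ys(1) len by (auto simp: inj_on_def I_def nth_eq_iff_index_eq)
  then have cS: "card S = card I" by (simp add: S_def card_image)
  have "bij_betw (\<lambda>i. ys ! Suc i) I {w. {u, w} \<in> H}"
  proof (rule bij_betw_imageI)
    show "inj_on (\<lambda>i. ys ! Suc i) I"
      using ys(1) len by (auto simp: inj_on_def I_def nth_eq_iff_index_eq)
    show "(\<lambda>i. ys ! Suc i) ` I = {w. {u, w} \<in> H}"
    proof (intro equalityI subsetI)
      fix w assume "w \<in> {w. {u, w} \<in> H}"
      then have w: "{u, w} \<in> H" by simp
      then have "w \<in> set ys" "w \<noteq> u" using nbV ys by auto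
      then obtain j where j: "j < N" "w = ys ! j" by (auto simp: in_set_conv_nth len)
      with \<open>w \<noteq> u\<close> have "j \<noteq> 0" using ys(4) ne by (metis hd_conv_nth)
      then obtain i where "j = Suc i" by (cases j) auto
      then show "w \<in> (\<lambda>i. ys ! Suc i) ` I" using j w by (auto simp: I_def)
    qed (auto simp: I_def)
  qed
  then have cSu: "card S = d u" using cS by (simp add: dn bij_betw_same_card)
  have SV: "S \<subseteq> V" using ys(2) len by (auto simp: S_def I_def)
  have Sv: "w \<noteq> v \<and> {v, w} \<notin> H" if "w \<in> S" for w
  proof -
    obtain i where i: "Suc i < N" "{u, ys ! Suc i} \<in> H" "w = ys ! i"
      using \<open>w \<in> S\<close> by (auto simp: S_def I_def)
    have "w \<noteq> v" using ys(1,5) i len ne by (auto simp: last_conv_nth nth_eq_iff_index_eq)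
    moreover have "{v, w} \<notin> H"
      using crossing_cycle[OF ys(1) _ ys(3), of i] N3 len i ys(2,4,5) nh
      by (auto simp: hamiltonian_def)
    ultimately show ?thesis by blast
  qed
  have Sd: "d w \<le> d u" if "w \<in> S" for w
    using mx[of w v] Sv[OF that] SV that uv(2) by (auto simp: insert_commute)
  \<comment> \<open>Yields \<open>d u + d v < N\<close>; together with \<open>d u \<le> d v\<close>
    this gives \<open>2 * d u < N\<close>.\<close>
  have "{w. {v, w} \<in> H} \<subseteq> V - insert v S" using nbV Sv by auto
  then have "d v \<le> card (V - insert v S)" unfolding dn using V by (intro card_mono) auto
  also have "\<dots> = N - (d u + 1)"
  proof -
    have fS: "finite S" and "v \<notin> S" using finI Sv by (auto simp: S_def)
    then have "card (insert v S) = d u + 1" using cSu by simp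
    then show ?thesis using SV uv(2) fS by (simp add: card_Diff_subset N_def)
  qed
  finally have dv: "d v \<le> N - (d u + 1)" .
  \<comment> \<open>For \<open>d u = 0\<close> the bound \<open>dv\<close> only gives
    \<open>d v \<le> N - 1\<close>, one too many for \<open>h = 1\<close>; nonadjacency of
    \<open>u\<close> and \<open>v\<close> saves one.\<close>
  have "{w. {v, w} \<in> H} \<subseteq> V - {u, v}" using nbV uv(4) by (auto simp: insert_commute)
  then have "d v \<le> card (V - {u, v})" unfolding dn using V by (intro card_mono) auto
  also have "\<dots> = N - 2" using uv V by (simp add: N_def)
  finally have dv2: "d v \<le> N - 2" .
  \<comment> \<open>\<open>T\<close> contains \<open>u\<close> itself, so it has exactly
    \<open>N - d u\<close> elements; for \<open>u\<close> the bound is \<open>d u \<le> d v\<close>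
    rather than maximality.\<close>
  define T where "T = {w \<in> V. {u, w} \<notin> H}"
  have Td: "d w \<le> d v" if "w \<in> T" for w
    using mx[of u w] that le uv(1) by (cases "w = u") (auto simp: T_def)
  have "T = V - {w. {u, w} \<in> H}" by (auto simp: T_def)
  then have cT: "card T = N - d u"
    using nbV V by (subst dn) (auto simp: N_def intro!: card_Diff_subset finite_subset[of _ V])
  show ?thesis
  proof (cases "d u = 0")
    case False
    have "d u \<le> card {v \<in> V. d v \<le> d u}"
      unfolding cSu[symmetric] using SV V Sd by (intro card_mono) (auto simp: cSu)
    moreover have "d v < N - d u" using dv dv2 le N3 by linarith
    then have "card T \<le> card {v \<in> V. d v < N - d u}"
      using V Td by (intro card_mono) (auto simp: T_def intro: le_less_trans)
    ultimately show ?thesis using False dv dv2 le N3 cT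
      by (intro exI[of _ "d u"]) (auto simp: N_def d_def)
  next
    case True
    have "card {u} \<le> card {v \<in> V. d v \<le> 1}"
      using V True uv by (intro card_mono) auto
    moreover have "card T \<le> card {v \<in> V. d v < N - 1}"
      using V Td dv2 N3 by (intro card_mono) (fastforce simp: T_def)+
    ultimately show ?thesis using N3 cT True
      by (intro exI[of _ 1]) (auto simp: N_def d_def)
  qed
qed

text \<open>A violation found in an edge-maximal non-Hamiltonian supergraph is already one in
  \<open>E\<close>, since adding edges only raises degrees. Counting vertices of low degree replaces
  the sorted degree sequence: the premise says that the \<open>h\<close>-th smallest degree is at
  most \<open>h\<close>, the conclusion that the one at place \<open>card V - h\<close> is at least
  \<open>card V - h\<close>.\<close>

theorem chvatal_hamiltonian:
  assumes G: "finite_simple_graph V E" and N: "card V \<ge> 3"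
    and chv: "\<And>h. 1 \<le> h \<Longrightarrow> 2 * h < card V \<Longrightarrow> h \<le> card {v \<in> V. degree E v \<le> h} \<Longrightarrow>
                card {v \<in> V. degree E v < card V - h} < card V - h"
  shows "hamiltonian V E"
proof (rule ccontr)
  assume nh: "\<not> hamiltonian V E"
  have V: "finite V" and sE: "\<forall>e\<in>E. e \<subseteq> V \<and> card e = 2"
    using G by (auto simp: finite_simple_graph_def)
  define \<H> where "\<H> = {H. H \<subseteq> {e. e \<subseteq> V \<and> card e = 2} \<and> \<not> hamiltonian V H}"
  have "finite \<H>"
    by (rule finite_subset[of _ "Pow (Pow V)"]) (auto simp: \<H>_def V)
  moreover have "E \<in> \<H>" using sE nh by (auto simp: \<H>_def)
  ultimately have "\<exists>H\<in>\<H>. E \<subseteq> H \<and> (\<forall>F\<in>\<H>. H \<subseteq> F \<longrightarrow> H = F)"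
    by (rule finite_has_maximal2)
  then obtain H where H: "H \<in> \<H>" "E \<subseteq> H" and mx: "\<forall>F\<in>\<H>. H \<subseteq> F \<longrightarrow> H = F"
    by (elim bexE conjE)
  have sH: "\<forall>e\<in>H. e \<subseteq> V \<and> card e = 2" and nhH: "\<not> hamiltonian V H"
    using H by (auto simp: \<H>_def)
  have finH: "finite H" using sH V by (intro finite_subset[of H "Pow V"]) auto
  have "hamiltonian V (insert {u, v} H)" if "u \<in> V" "v \<in> V" "u \<noteq> v" "{u, v} \<notin> H" for u v
  proof (rule ccontr)
    assume "\<not> hamiltonian V (insert {u, v} H)"
    then have "insert {u, v} H \<in> \<H>" using sH that by (auto simp: \<H>_def)
    then show False using mx[rule_format, of "insert {u, v} H"] that(4) by blast
  qed
  from maximal_non_hamiltonian[OF V N sH nhH this]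
  obtain h where h: "1 \<le> h" "2 * h < card V" "h \<le> card {v \<in> V. degree H v \<le> h}"
    "card V - h \<le> card {v \<in> V. degree H v < card V - h}" by blast
  note dm = degree_mono[OF H(2) finH]
  have "card {v \<in> V. degree H v \<le> h} \<le> card {v \<in> V. degree E v \<le> h}"
    using V dm by (intro card_mono) (auto intro: le_trans)
  moreover have "card {v \<in> V. degree H v < card V - h} \<le> card {v \<in> V. degree E v < card V - h}"
    using V dm by (intro card_mono) (auto intro: le_less_trans)
  ultimately show False using chv[of h] h by linarith
qed

section \<open>Missing edges of a balanced multipartite graph\<close>

text \<open>\<open>M\<close> is the complement of \<open>E\<close> in the complete multipartite
  graph \<open>K\<close> on the same parts, which is regular of degree \<open>(k - 1) * n\<close>.
  The edge count is the handshake identity for \<open>K\<close>, kept doubled to avoid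
  division.\<close>

lemma balanced_missing_edges:
  assumes G: "finite_simple_graph V E"
    and P: "(\<Union>i\<in>{1..k}. P i) = V" "disjoint_family_on P {1..k}"
      "\<forall>i\<in>{1..k}. card (P i) = n" "\<forall>e\<in>E. \<forall>i\<in>{1..k}. \<not> e \<subseteq> P i"
  obtains M where "finite_simple_graph V M"
    "\<And>v. v \<in> V \<Longrightarrow> degree M v + degree E v = (k - 1) * n"
    "2 * (card M + card E) = k * n * ((k - 1) * n)"
    "card V = k * n"
    "\<forall>e\<in>M. \<forall>i\<in>{1..k}. \<not> e \<subseteq> P i"
proof -
  note fin = finite_simple_graph_finite[OF G]
  have finP: "finite (P i)" if "i \<in> {1..k}" for i
    using P(1) fin(2) that by (auto intro: finite_subset)
  have cV: "card V = k * n"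
    unfolding P(1)[symmetric] using P(2,3) finP
    by (subst card_UN_disjoint) (auto simp: disjoint_family_on_def)
  define K where "K = {e. e \<subseteq> V \<and> card e = 2 \<and> (\<forall>i\<in>{1..k}. \<not> e \<subseteq> P i)}"
  have sK: "finite_simple_graph V K" using fin by (auto simp: finite_simple_graph_def K_def)
  have EK: "E \<subseteq> K" using G P(4) by (auto simp: finite_simple_graph_def K_def)
  note finK = finite_simple_graph_finite(1)[OF sK]
  have dK: "degree K v = (k - 1) * n" if v: "v \<in> V" for v
  proof -
    obtain i where i: "i \<in> {1..k}" "v \<in> P i" using v P(1) by auto
    have "{w. {v, w} \<in> K} = V - P i"
    proof (intro equalityI subsetI)
      fix w assume "w \<in> {w. {v, w} \<in> K}"
      then show "w \<in> V - P i" using i by (auto simp: K_def)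
    next
      fix w assume w: "w \<in> V - P i"
      then have "v \<noteq> w" using i by auto
      moreover have "\<not> {v, w} \<subseteq> P j" if "j \<in> {1..k}" for j
        using disjoint_family_onD[OF P(2) that i(1)] i w by (cases "j = i") auto
      ultimately show "w \<in> {w. {v, w} \<in> K}" using v w by (auto simp: K_def)
    qed
    moreover have "P i \<subseteq> V" using P(1) i by auto
    ultimately show ?thesis
      using degree_eq_card_neighbours[of K v] finP[OF i(1)] P(3) i cV
      by (simp add: K_def card_Diff_subset diff_mult_distrib)
  qed
  have "(\<Sum>e\<in>K. card (e \<inter> V)) = (\<Sum>e\<in>K. 2)"
    by (intro sum.cong) (auto simp: K_def Int_absorb2)
  then have "2 * card K = k * n * ((k - 1) * n)"
    using sum_degree_eq[OF finK fin(2)] dK cV by simp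
  moreover have "card K = card (K - E) + card E"
    using EK finK fin by (simp add: card_Diff_subset card_mono)
  moreover have "degree (K - E) v + degree E v = (k - 1) * n" if "v \<in> V" for v
  proof -
    have "K - E \<union> E = K" "(K - E) \<inter> E = {}" using EK by auto
    then show ?thesis using degree_Un_disjoint[of "K - E" E v] finK fin dK[OF that] by simp
  qed
  moreover have "finite_simple_graph V (K - E)"
    using sK by (simp add: finite_simple_graph_def)
  moreover have "\<forall>e\<in>K - E. \<forall>i\<in>{1..k}. \<not> e \<subseteq> P i" by (simp add: K_def)
  ultimately show thesis using that[of "K - E"] cV by simp
qed

lemma sum_degree_independent:
  assumes M: "finite_simple_graph V M" and S: "finite S" "\<forall>e\<in>M. card (e \<inter> S) \<le> 1"
  shows "(\<Sum>v\<in>S. degree M v) \<le> card M"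
  using sum_mono[of M "\<lambda>e. card (e \<inter> S)" "\<lambda>_. 1"] S
    sum_degree_eq[OF finite_simple_graph_finite(1)[OF M] S(1)] by simp

lemma degree_le_card:
  assumes M: "finite_simple_graph V M"
  shows "degree M v \<le> card M"
  unfolding degree_def using finite_simple_graph_finite[OF M] by (intro card_mono) auto

text \<open>Only the edge \<open>{u, v}\<close> can be counted at both vertices.\<close>

lemma degree_pair_le_card:
  assumes M: "finite_simple_graph V M" and "u \<noteq> v"
  shows "degree M u + degree M v \<le> card M + 1"
proof -
  note fin = finite_simple_graph_finite(1)[OF M]
  have "{e \<in> M. u \<in> e} \<inter> {e \<in> M. v \<in> e} \<subseteq> {{u, v}}"
  proof
    fix e assume e: "e \<in> {e \<in> M. u \<in> e} \<inter> {e \<in> M. v \<in> e}"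
    then have "card e = 2" using M by (auto simp: finite_simple_graph_def)
    then show "e \<in> {{u, v}}" using e \<open>u \<noteq> v\<close> by (auto simp: card_2_iff)
  qed
  then have "card ({e \<in> M. u \<in> e} \<inter> {e \<in> M. v \<in> e}) \<le> card {{u, v}}"
    by (intro card_mono) auto
  moreover have "card ({e \<in> M. u \<in> e} \<union> {e \<in> M. v \<in> e}) \<le> card M"
    using fin by (intro card_mono) auto
  moreover have "degree M u + degree M v =
      card ({e \<in> M. u \<in> e} \<union> {e \<in> M. v \<in> e}) + card ({e \<in> M. u \<in> e} \<inter> {e \<in> M. v \<in> e})"
    unfolding degree_def using fin by (intro card_Un_Int) auto
  ultimately show ?thesis by simp
qed

section \<open>At least three parts\<close>

lemma hamiltonian_of_few_missing:
  assumes G: "finite_simple_graph V E" and M: "finite_simple_graph V M"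
    and deg: "\<And>v. v \<in> V \<Longrightarrow> degree M v + degree E v = (k - 1) * n"
    and cV: "card V = k * n" and k: "k \<ge> 3" and n: "n \<ge> 1"
    and m: "card M + 2 \<le> (k - 1) * n"
  shows "hamiltonian V E"
proof (rule chvatal_hamiltonian[OF G])
  show "card V \<ge> 3" using mult_le_mono[OF k n] cV by simp
next
  fix h assume h: "1 \<le> h" "2 * h < card V" "h \<le> card {v \<in> V. degree E v \<le> h}"
  note fin = finite_simple_graph_finite(2)[OF G]
  define m where "m = card M"
  define D q where "D = (k - 1) * n" and "q = (k - 2) * n"
  obtain j where j: "k = j + 3" using k le_Suc_ex by (metis add.commute)
  \<comment> \<open>Writing everything in \<open>q\<close> and \<open>n\<close> removes truncated
    subtraction; \<open>k \<ge> 3\<close> enters as \<open>n \<le> q\<close>.\<close>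
  have D: "D = q + n" and N: "card V = q + 2 * n" and nq: "n \<le> q"
    using cV by (auto simp: D_def q_def j algebra_simps)
  have mD: "m + 2 \<le> D" using m by (simp add: m_def D_def)
  have dM: "degree M v + degree E v = D" if "v \<in> V" for v
    using deg[OF that] by (simp add: D_def)
  show "card {v \<in> V. degree E v < card V - h} < card V - h"
  proof (rule ccontr)
    let ?B = "{v \<in> V. degree E v < card V - h}"
    assume "\<not> card ?B < card V - h"
    then have B: "card V - h \<le> card ?B" by simp
    obtain S where S: "S \<subseteq> {v \<in> V. degree E v \<le> h}" "card S = h" "finite S"
      using obtain_subset_with_card_n[OF h(3)] by blast
    \<comment> \<open>\<open>S\<close> has only \<open>h < card V - h\<close> elements, too few to
      cover \<open>?B\<close>.\<close>
    have "\<not> ?B \<subseteq> S" using card_mono[OF S(3), of ?B] B S(2) h(2) by linarith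
    then obtain z where z: "z \<in> V" "degree E z < card V - h" "z \<notin> S" by auto
    have SM: "D - h \<le> degree M v" if "v \<in> S" for v
    proof -
      have "v \<in> V" "degree E v \<le> h" using S(1) that by auto
      then show ?thesis using dM[of v] by linarith
    qed
    obtain v where v: "v \<in> S" using S(2) h(1) by fastforce
    \<comment> \<open>For \<open>h = 1\<close> a single vertex would miss \<open>D - 1\<close>
      edges, but at most \<open>D - 2\<close> are missing in all.\<close>
    have h2: "h \<ge> 2"
      using SM[OF v] degree_le_card[OF M, of v] mD by (simp add: m_def)
    have "(\<Sum>e\<in>M. card (e \<inter> V)) = (\<Sum>e\<in>M. 2)"
      using M by (intro sum.cong) (auto simp: finite_simple_graph_def Int_absorb2)
    then have "(\<Sum>v\<in>V. degree M v) = 2 * m"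
      using sum_degree_eq[OF finite_simple_graph_finite(1)[OF M] fin] by (simp add: m_def)
    moreover have "(\<Sum>v\<in>insert z S. degree M v) \<le> (\<Sum>v\<in>V. degree M v)"
      using z S fin by (intro sum_mono2) auto
    moreover have "h * (D - h) \<le> (\<Sum>v\<in>S. degree M v)"
      using sum_mono[of S "\<lambda>_. D - h" "degree M"] SM S(2) by simp
    ultimately have tot: "degree M z + h * (D - h) \<le> 2 * m" using z(3) S(3) by simp
    have Mz: "h + 1 \<le> degree M z + n" using dM[OF z(1)] z(2) D N by linarith
    have hD: "h \<le> D" using h(2) D N nq by linarith
    show False
    proof (cases "h = 2")
      case True
      \<comment> \<open>Both vertices miss at least \<open>D - 2\<close> edges and share at most
        one, so \<open>2 * (D - 2) \<le> D - 1\<close> and \<open>D \<le> 3\<close>. But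
        \<open>card V > 4\<close> and \<open>n \<le> q\<close> force
        \<open>D \<ge> 4\<close>.\<close>
      then obtain x y where xy: "S = {x, y}" "x \<noteq> y" using S(2) by (auto simp: card_2_iff)
      then show False
        using degree_pair_le_card[OF M xy(2)] SM[of x] SM[of y] True mD D N nq n h(2)
        by (simp add: m_def)
    next
      case False
      then have h3: "h \<ge> 3" using h2 by simp
      have "int (degree M z) + int h * (int D - int h) \<le> 2 * (int D - 2)"
        using tot mD hD by (simp flip: of_nat_diff of_nat_mult of_nat_add)
      then have key: "int (degree M z) + (int h - 2) * (int D - int h - 2) \<le> 0"
        by (simp add: algebra_simps)
      have "int D - int h - 2 \<ge> 0"
        using h3 h(2) D N nq by linarith
      then have "(int h - 2) * (int D - int h - 2) \<ge> (int D - int h - 2)"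
        using h3 mult_right_mono[of 1 "int h - 2" "int D - int h - 2"] by simp
      \<comment> \<open>Equality is forced: \<open>h = D - 2\<close> and
        \<open>degree M z = 0\<close>. Then \<open>Mz\<close> gives \<open>h + 1 \<le> n\<close>,
        hence \<open>q \<le> 1\<close>, and \<open>n \<le> q\<close> leaves no room for
        \<open>h \<ge> 3\<close>.\<close>
      then show False using key Mz h3 h(2) D N nq by linarith
    qed
  qed
qed

section \<open>Two parts\<close>

text \<open>Making one side of a balanced bipartite graph complete creates no new Hamiltonian
  cycle, since the other side is independent and contains half of the vertices.\<close>

lemma hamiltonian_complete_side:
  assumes AB: "A \<inter> B = {}" "finite A" "finite B" "card A = card B"
    and E: "\<forall>e\<in>E. \<not> e \<subseteq> B"
    and ham: "hamiltonian (A \<union> B) (E \<union> {e. e \<subseteq> A \<and> card e = 2})"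
  shows "hamiltonian (A \<union> B) E"
proof -
  obtain xs where cyc: "graph_cycle (E \<union> {e. e \<subseteq> A \<and> card e = 2}) xs" and xs: "set xs = A \<union> B"
    using ham by (auto simp: hamiltonian_def)
  define N where "N = length xs"
  have N: "N \<ge> 3" and d: "distinct xs" and
    e: "\<And>i. i < N \<Longrightarrow> {xs ! i, xs ! ((i + 1) mod N)} \<in> E \<union> {e. e \<subseteq> A \<and> card e = 2}"
    using cyc by (auto simp: graph_cycle_def N_def)
  define pos where "pos X = {i. i < N \<and> xs ! i \<in> X}" for X
  have card_pos: "card (pos X) = card X" if "X \<subseteq> A \<union> B" for X
  proof -
    have "bij_betw ((!) xs) (pos X) X"
    proof (rule bij_betw_imageI)
      show "inj_on ((!) xs) (pos X)"
        using d by (auto simp: inj_on_def pos_def N_def nth_eq_iff_index_eq)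
      show "(!) xs ` pos X = X"
        using that xs by (force simp: pos_def N_def set_conv_nth)
    qed
    then show ?thesis by (rule bij_betw_same_card)
  qed
  have fin: "finite (pos X)" for X by (simp add: pos_def)
  define succ where "succ i = (i + 1) mod N" for i
  \<comment> \<open>Neither \<open>E\<close> nor the added edges join two vertices of
    \<open>B\<close>, so a vertex of \<open>B\<close> is followed by one of
    \<open>A\<close>.\<close>
  have sub: "succ ` pos B \<subseteq> pos A"
  proof
    fix x assume "x \<in> succ ` pos B"
    then obtain i where i: "i < N" "xs ! i \<in> B" "x = succ i" by (auto simp: pos_def)
    have x: "x < N" using N i by (simp add: succ_def)
    then have "xs ! x \<in> A \<union> B" using xs by (auto simp: N_def)
    moreover have "xs ! x \<notin> B" using e[OF i(1)] i AB(1) E by (auto simp: succ_def)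
    ultimately show "x \<in> pos A" using x by (simp add: pos_def)
  qed
  have inj: "inj_on succ {..<N}"
    using N by (auto simp: inj_on_def succ_def mod_Suc split: if_splits)
  have "inj_on succ (pos B)" by (rule inj_on_subset[OF inj]) (auto simp: pos_def)
  \<comment> \<open>An injection between sets of equal size is onto, so every vertex of
    \<open>A\<close> is preceded by one of \<open>B\<close>; an added edge would violate
    this.\<close>
  then have "succ ` pos B = pos A"
    using sub fin card_pos[of A] card_pos[of B] AB(4)
    by (intro card_subset_eq) (auto simp: card_image)
  have "{xs ! i, xs ! succ i} \<in> E" if i: "i < N" for i
  proof (rule ccontr)
    assume "{xs ! i, xs ! succ i} \<notin> E"
    then have "xs ! i \<in> A" "xs ! succ i \<in> A" using e[OF i] by (auto simp: succ_def)
    moreover have "succ i < N" using N by (simp add: succ_def)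
    ultimately have "succ i \<in> succ ` pos B"
      using \<open>succ ` pos B = pos A\<close> by (simp add: pos_def)
    then obtain l where "l < N" "xs ! l \<in> B" "succ l = succ i" by (auto simp: pos_def)
    then have "l = i" using inj i by (auto dest: inj_onD)
    then show False using \<open>xs ! l \<in> B\<close> \<open>xs ! i \<in> A\<close> AB(1) by auto
  qed
  then have "graph_cycle E xs" using N d by (simp add: graph_cycle_def N_def succ_def)
  then show ?thesis using xs by (auto simp: hamiltonian_def)
qed

lemma degree_complete:
  assumes "finite A" "v \<in> A"
  shows "degree {e. e \<subseteq> A \<and> card e = 2} v = card A - 1"
proof -
  have "{w. {v, w} \<in> {e. e \<subseteq> A \<and> card e = 2}} = A - {v}"
    using assms by (auto simp: card_insert_if)
  then show ?thesis
    using degree_eq_card_neighbours[of "{e. e \<subseteq> A \<and> card e = 2}" v] assms by simp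
qed

text \<open>Once \<open>A\<close> is complete, the \<open>h\<close> vertices of low degree all lie
  in the independent side \<open>B\<close>, where no missing edge is counted twice. This gives
  \<open>h * (n - h) \<le> card M \<le> n - 2\<close>, which is impossible for
  \<open>0 < h < n\<close>, so the premise of Chvatal's condition never holds.\<close>

lemma hamiltonian_bipartite_of_few_missing:
  assumes G: "finite_simple_graph V E" and M: "finite_simple_graph V M"
    and V: "V = A \<union> B" and AB: "A \<inter> B = {}" "card A = n" "card B = n"
    and EAB: "\<forall>e\<in>E. \<not> e \<subseteq> A \<and> \<not> e \<subseteq> B" and MB: "\<forall>e\<in>M. \<not> e \<subseteq> B"
    and deg: "\<And>v. v \<in> V \<Longrightarrow> degree M v + degree E v = n"
    and n: "n \<ge> 2" and m: "card M + 2 \<le> n"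
  shows "hamiltonian V E"
proof -
  have fin: "finite A" "finite B" using finite_simple_graph_finite(2)[OF G] V by auto
  have cV: "card V = 2 * n" using AB fin by (simp add: V card_Un_disjoint)
  define C where "C = {e. e \<subseteq> A \<and> card e = 2}"
  have finC: "finite C" using fin by (auto simp: C_def intro: finite_subset[of _ "Pow A"])
  have dEC: "degree (E \<union> C) v = degree E v + degree C v" for v
    using finC EAB finite_simple_graph_finite(1)[OF G]
    by (intro degree_Un_disjoint) (auto simp: C_def)
  have "hamiltonian V (E \<union> C)"
  proof (rule chvatal_hamiltonian)
    show "finite_simple_graph V (E \<union> C)" using G V by (auto simp: finite_simple_graph_def C_def)
    show "card V \<ge> 3" using cV n by simp
  next
    fix h assume h: "1 \<le> h" "2 * h < card V" "h \<le> card {v \<in> V. degree (E \<union> C) v \<le> h}"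
    obtain S where S: "S \<subseteq> {v \<in> V. degree (E \<union> C) v \<le> h}" "card S = h" "finite S"
      using obtain_subset_with_card_n[OF h(3)] by blast
    have SB: "v \<in> B" and SM: "n - h \<le> degree M v" if "v \<in> S" for v
    proof -
      have v: "v \<in> V" "degree E v + degree C v \<le> h" using S(1) that dEC by auto
      show "n - h \<le> degree M v" using deg[OF v(1)] v(2) by linarith
      \<comment> \<open>A vertex of \<open>A\<close> has degree at least
        \<open>n - 1 \<ge> h\<close>, so it could only qualify with no edge in \<open>E\<close>; it
        would then miss \<open>n > card M\<close> edges.\<close>
      have "v \<notin> A"
      proof
        assume "v \<in> A"
        then have "degree C v = n - 1" using degree_complete[OF fin(1)] AB by (simp add: C_def)
        then show False
          using deg[OF v(1)] v(2) degree_le_card[OF M, of v] m h(2) cV by linarith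
      qed
      then show "v \<in> B" using v V by auto
    qed
    have "card (e \<inter> S) \<le> 1" if "e \<in> M" for e
    proof -
      have e: "card e = 2" "\<not> e \<subseteq> S"
        using M MB SB that by (auto simp: finite_simple_graph_def) (meson subset_iff)
      then have "card (e \<inter> S) < card e"
        by (intro psubset_card_mono) (auto intro: card_ge_0_finite)
      then show ?thesis using e by simp
    qed
    then have "(\<Sum>v\<in>S. degree M v) \<le> card M"
      by (intro sum_degree_independent[OF M S(3)]) auto
    then have "h * (n - h) \<le> card M"
      using sum_mono[of S "\<lambda>_. n - h" "degree M"] SM S(2) by simp
    \<comment> \<open>With both factors positive,
      \<open>Suc a * Suc b \<ge> a + b + 1 = n - 1 > card M\<close>.\<close>
    moreover obtain a b where "h = Suc a" "n - h = Suc b"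
      using h cV by (metis Suc_diff_Suc Suc_le_D mult_less_cancel1 One_nat_def)
    ultimately show "card {v \<in> V. degree (E \<union> C) v < card V - h} < card V - h"
      using m by simp
  qed
  then show ?thesis
    unfolding V C_def using hamiltonian_complete_side[OF AB(1) fin] AB EAB by auto
qed

theorem theorem1:
  fixes k n :: nat and V :: "'a set" and E :: "'a set set"
  assumes "k \<ge> 2" and "n \<ge> 1" and "(k, n) \<noteq> (2, 1)"
    and "balanced_multipartite_graph n k V E"
    and "int (card E) \<ge> (int n)\<^sup>2 * int (k choose 2) - (int k - 1) * int n + 2"
  shows "hamiltonian V E"
proof -
  obtain P where G: "finite_simple_graph V E" and P: "(\<Union>i\<in>{1..k}. P i) = V"
      "disjoint_family_on P {1..k}" "\<forall>i\<in>{1..k}. card (P i) = n"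
      "\<forall>e\<in>E. \<forall>i\<in>{1..k}. \<not> e \<subseteq> P i"
    using assms(4) by (auto simp: balanced_multipartite_graph_def)
  have k1: "k \<ge> 1" using assms(1) by simp
  obtain M where M: "finite_simple_graph V M"
    "\<And>v. v \<in> V \<Longrightarrow> degree M v + degree E v = (k - 1) * n"
    "2 * (card M + card E) = k * n * ((k - 1) * n)"
    "card V = k * n"
    "\<forall>e\<in>M. \<forall>i\<in>{1..k}. \<not> e \<subseteq> P i"
    using balanced_missing_edges[OF G P] by blast
  \<comment> \<open>The leading term of the edge bound is the size of the complete balanced graph,
    so the hypothesis says that at most \<open>(k - 1) * n - 2\<close> edges are missing.\<close>
  have "2 * (k choose 2) = k * (k - 1)" by (cases k) (simp_all add: choose_two)
  then have "2 * (n\<^sup>2 * (k choose 2)) = k * n * ((k - 1) * n)"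
    by (metis mult.assoc mult.commute mult.left_commute power2_eq_square)
  then have "card M + card E = n\<^sup>2 * (k choose 2)" using M(3) by simp
  then have "int (card M) + int (card E) = (int n)\<^sup>2 * int (k choose 2)"
    by (simp flip: of_nat_add of_nat_mult of_nat_power)
  moreover have "(int k - 1) * int n = int ((k - 1) * n)" using k1 by (simp add: of_nat_diff)
  ultimately have m: "card M + 2 \<le> (k - 1) * n" using assms(5) by linarith
  show ?thesis
  proof (cases "k = 2")
    case False
    then show ?thesis
      using hamiltonian_of_few_missing[OF G M(1,2,4) _ assms(2) m] assms(1) by simp
  next
    case True
    have ks: "{1..k} = {1, 2}" using True by auto
    note P' = P[unfolded ks] and M' = M(5)[unfolded ks]
    have dis: "P 1 \<inter> P 2 = {}" using disjoint_family_onD[OF P'(2), of 1 2] by simp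
    show ?thesis
      by (rule hamiltonian_bipartite_of_few_missing[OF G M(1), of "P 1" "P 2" n])
        (use P' M' M(2) m dis True assms(2,3) in auto)
  qed
qed

end
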